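(* Assume that $p\in C^1[0,+\infty)$, $\int_0^1\frac{p(\rho)}{\rho^2}d\rho<+\infty$, $\lim_{\rho\to\infty}\frac{p(\rho)}{\rho^\gamma}=K$, $p(\rho)\ge0$, and $p'(\rho)>0$ for $\rho>0$, where $0<K<+\infty$ and $\gamma\ge4/3$ are constants. Then there exists a constant $\mathfrak M_c$, with $0<\mathfrak M_c<\infty$ if $\gamma=4/3$ and $\mathfrak M_c=\infty$ if $\gamma>4/3$, such that if $0<M<\mathfrak M_c$ and $L\in C^1[0,M]$ satisfies $L(0)=0$ and $L(m)\ge0$ for $0\le m\le M$, then there are positive constants $C_1,C_2$ such that for all $\rho\in W_M$, $$\int\Big[A(\rho(x))+\frac12\frac{\rho(x)L(m_\rho(r(x)))}{r(x)^2}\Big]dx\le C_1F(\rho)+C_2.$$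
   Context: Here $\int=\int_{\mathbb R^3}$, and for $x\in\mathbb R^3$, $r(x)=\sqrt{x_1^2+x_2^2}$. A function on $\mathbb R^3$ is axisymmetric if it depends only on $(r(x),x_3)$. $Bf(x)=\int\frac{f(y)}{|x-y|}dy$; $m_\rho(r)=\int_{\{r(x)<r\}}\rho(x)\,dx$; $A(\rho)=\rho\int_0^\rho\frac{p(s)}{s^2}ds$. For $M>0$, $$W_M=\Big\{\rho:\mathbb R^3\to\mathbb R:\ \rho\text{ axisymmetric},\ \rho\ge0\text{ a.e.},\ \int\rho\,dx=M,\ \int\Big(A(\rho(x))+\frac{\rho(x)L(m_\rho(r(x)))}{r(x)^2}+\rho(x)B\rho(x)\Big)dx<+\infty\Big\},$$ $$F(\rho)=\int\Big[A(\rho(x))+\frac12\frac{\rho(x)L(m_\rho(r(x)))}{r(x)^2}-\frac12\rho(x)B\rho(x)\Big]dx,\qquad\rho\in W_M.$$ *)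

theory Defs
  imports "HOL-Analysis.Analysis"
begin

text \<open>
  Functions on \<open>[0, \<infinity>)\<close> or \<open>[0, M]\<close> are total functions on the reals; only their values on the
  stated interval matter. Derivatives are taken within the interval, hence one-sided at its ends.
\<close>

definition C1_on :: "real set \<Rightarrow> (real \<Rightarrow> real) \<Rightarrow> bool" where
  "C1_on S f \<longleftrightarrow>
     (\<exists>f'. (\<forall>x\<in>S. (f has_real_derivative f' x) (at x within S)) \<and> continuous_on S f')"

definition axis_dist :: "real^3 \<Rightarrow> real" where
  "axis_dist x = sqrt ((x$1)\<^sup>2 + (x$2)\<^sup>2)"

definition axisymmetric :: "(real^3 \<Rightarrow> real) \<Rightarrow> bool" where
  "axisymmetric f \<longleftrightarrow> (\<exists>g. \<forall>x. f x = g (axis_dist x, x$3))"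

text \<open>
  For a Lebesgue integrable density the integral defining the potential converges at almost every
  point; at the exceptional points the Bochner integral is 0 by convention.
\<close>

definition potential :: "(real^3 \<Rightarrow> real) \<Rightarrow> real^3 \<Rightarrow> real" where
  "potential f x = (LINT y|lebesgue. f y / norm (x - y))"

definition cyl_mass :: "(real^3 \<Rightarrow> real) \<Rightarrow> real \<Rightarrow> real" where
  "cyl_mass \<rho> r = (LINT x:{x. axis_dist x < r}|lebesgue. \<rho> x)"

definition internal_energy :: "(real \<Rightarrow> real) \<Rightarrow> real \<Rightarrow> real" where
  "internal_energy p \<rho> = \<rho> * (LBINT s=0..\<rho>. p s / s\<^sup>2)"

definition rotation_term :: "(real \<Rightarrow> real) \<Rightarrow> (real^3 \<Rightarrow> real) \<Rightarrow> real^3 \<Rightarrow> real" where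
  "rotation_term L \<rho> x = \<rho> x * L (cyl_mass \<rho> (axis_dist x)) / (axis_dist x)\<^sup>2"

text \<open>
  The last integrand is measurable and, for the pressures and rotation laws considered,
  nonnegative almost everywhere, so finiteness of its integral is the same as integrability.
\<close>

definition admissible :: "(real \<Rightarrow> real) \<Rightarrow> (real \<Rightarrow> real) \<Rightarrow> real \<Rightarrow> (real^3 \<Rightarrow> real) set" where
  "admissible p L M = {\<rho>.
     axisymmetric \<rho> \<and>
     (AE x in lebesgue. 0 \<le> \<rho> x) \<and>
     integrable lebesgue \<rho> \<and> (LINT x|lebesgue. \<rho> x) = M \<and>
     integrable lebesgue
       (\<lambda>x. internal_energy p (\<rho> x) + rotation_term L \<rho> x + \<rho> x * potential \<rho> x)}"

definition energy :: "(real \<Rightarrow> real) \<Rightarrow> (real \<Rightarrow> real) \<Rightarrow> (real^3 \<Rightarrow> real) \<Rightarrow> real" where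
  "energy p L \<rho> =
     (LINT x|lebesgue. internal_energy p (\<rho> x) + 1/2 * rotation_term L \<rho> x
        - 1/2 * (\<rho> x * potential \<rho> x))"

end

theory Submission imports Defs begin

text \<open>
  The gravitational energy is controlled by the internal energy. By symmetry of the Coulomb kernel
  the double integral of \<open>\<rho> x * \<rho> y / norm (x - y)\<close> is at most twice its part over
  \<open>\<rho> y \<le> \<rho> x\<close>. There \<open>\<rho> y\<close> is bounded by \<open>s = \<rho> x\<close> and has mass at most \<open>M\<close>, so splitting the
  inner integral at \<open>norm (x - y) = (M / s) powr (1/3)\<close> bounds it by a multiple of
  \<open>M powr (2/3) * s powr (1/3)\<close>. Hence the gravitational energy is at most a multiple of
  \<open>M powr (2/3)\<close> times the integral of \<open>\<rho> powr (4/3)\<close>. Since the internal energy density grows at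
  least like \<open>s powr \<gamma>\<close>, that integral is at most \<open>a\<close> times the internal energy plus \<open>b * M\<close>, where
  \<open>a\<close> can be chosen arbitrarily small if \<open>\<gamma> > 4/3\<close>, while a fixed \<open>a\<close> and a small mass \<open>M\<close> do
  if \<open>\<gamma> = 4/3\<close>.
\<close>

section \<open>The Coulomb kernel and the gravitational energy of Borel densities\<close>

lemma nn_integral_inverse_norm_ball:
  fixes x :: "real^3" and R :: real
  assumes "R > 0"
  shows "(\<integral>\<^sup>+y. ennreal (indicator (ball x R) y / norm (x - y)) \<partial>lborel)
           \<le> ennreal (8/3 * unit_ball_vol 3 * R\<^sup>2)"
proof -
  define V where "V = unit_ball_vol 3"
  have V: "V > 0" unfolding V_def by simp
  have [measurable]: "ball x r \<in> sets borel" for r by simp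
  \<comment> \<open>Dyadic decomposition: on the shell of distances between
    \<open>R / 2^(k+1)\<close> and \<open>R / 2^k\<close> the kernel is at most
    \<open>2^(k+1) / R\<close>. Replacing each shell by the full ball makes the sum of the integrals
    a geometric series with ratio 1/4. The price is the factor 8/3 in place of the exact
    3/2.\<close>
  define g :: "nat \<Rightarrow> real^3 \<Rightarrow> ennreal" where
    "g k y = ennreal (2 ^ Suc k / R) * indicator (ball x (R * (1/2)^k)) y" for k y
  have le: "ennreal (indicator (ball x R) y / norm (x - y)) \<le> (\<Sum>k. g k y)" for y
  proof (cases "y \<in> ball x R \<and> y \<noteq> x")
    \<comment> \<open>This includes \<open>y = x\<close>, where the quotient is 0 by the convention
      for division by zero.\<close>
    case False
    then show ?thesis by (auto simp: indicator_def)
  next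
    case True
    define d where "d = norm (x - y)"
    have d: "0 < d" "d < R" using True by (auto simp: d_def dist_norm)
    obtain m where "(1/2)^m < d / R"
      using real_arch_pow_inv[of "d/R" "1/2"] d assms by auto
    then have ex: "\<exists>m. R * (1/2)^m \<le> d"
      using assms by (intro exI[of _ m]) (simp add: field_simps)
    \<comment> \<open>The first radius not exceeding \<open>d\<close>; its predecessor
      \<open>k\<close> exists because \<open>d < R\<close>, and it indexes the shell that contains
      \<open>y\<close>.\<close>
    define m where "m = (LEAST m. R * (1/2)^m \<le> d)"
    have m: "R * (1/2)^m \<le> d" unfolding m_def using ex by (rule LeastI_ex)
    have "m \<noteq> 0" using m d by (intro notI) simp
    then obtain k where k: "m = Suc k" by (cases m) auto
    have k': "d < R * (1/2)^k"
      using not_less_Least[of k "\<lambda>m. R * (1/2)^m \<le> d"] k unfolding m_def[symmetric] by simp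
    have "1 / d \<le> 2 ^ Suc k / R"
      using m k d assms by (simp add: field_simps power_one_over)
    then have "ennreal (indicator (ball x R) y / norm (x - y)) \<le> g k y"
      using True k' by (simp add: g_def d_def[symmetric] dist_norm ennreal_leI)
    also have "\<dots> \<le> (\<Sum>k. g k y)"
      using sum_le_suminf[of "\<lambda>k. g k y" "{k}"] by simp
    finally show ?thesis .
  qed
  have sums: "(\<lambda>k. 2 * V * R\<^sup>2 * (1/4)^k) sums (8/3 * V * R\<^sup>2)"
    using sums_mult[OF geometric_sums[of "1/4::real"], of "2 * V * R\<^sup>2"] by (simp add: mult.assoc)
  have "(\<integral>\<^sup>+y. ennreal (indicator (ball x R) y / norm (x - y)) \<partial>lborel)
          \<le> (\<integral>\<^sup>+y. (\<Sum>k. g k y) \<partial>lborel)"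
    by (intro nn_integral_mono le)
  also have "\<dots> = (\<Sum>k. (\<integral>\<^sup>+y. g k y \<partial>lborel))"
    by (intro nn_integral_suminf) (unfold g_def, measurable)
  also have "\<dots> = (\<Sum>k. ennreal (2 * V * R\<^sup>2 * (1/4)^k))"
  proof (intro suminf_cong)
    fix k
    have "(\<integral>\<^sup>+y. g k y \<partial>lborel) = ennreal (2 ^ Suc k / R) * ennreal (V * (R * (1/2)^k)^3)"
      using assms unfolding g_def
      by (subst nn_integral_cmult_indicator) (simp_all add: emeasure_ball V_def)
    also have "\<dots> = ennreal (2 ^ Suc k / R * (V * (R * (1/2)^k)^3))"
      using assms V by (intro ennreal_mult[symmetric]) auto
    also have "2 ^ Suc k / R * (V * (R * (1/2)^k)^3) = 2 * V * R\<^sup>2 * (2^k * ((1/2)^k)^3)"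
      using assms by (simp add: field_simps power_mult_distrib power2_eq_square power3_eq_cube)
    also have "2^k * ((1/2)^k)^3 = ((1/4)^k :: real)"
      by (simp add: power_mult[symmetric] mult.commute[of k] power_mult power_mult_distrib[symmetric] power3_eq_cube)
    finally show "(\<integral>\<^sup>+y. g k y \<partial>lborel) = ennreal (2 * V * R\<^sup>2 * (1/4)^k)" .
  qed
  also have "\<dots> = ennreal (8/3 * V * R\<^sup>2)"
    using sums_unique[OF sums] sums_summable[OF sums] V by (subst suminf_ennreal2) auto
  finally show ?thesis by (simp add: V_def)
qed

text \<open>The first summand is the constant of the integral of the kernel over a ball; the summand
  1 accounts for the mass outside that ball, where the kernel is at most
  \<open>1 / R\<close>.\<close>

definition coulomb_const :: real where
  "coulomb_const = 8/3 * unit_ball_vol 3 + 1"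

lemma coulomb_const_pos: "coulomb_const > 0"
  by (simp add: coulomb_const_def add_pos_pos)

lemma potential_bound_of_bounded_part:
  fixes f :: "real^3 \<Rightarrow> real" and x :: "real^3" and s M :: real
  assumes [measurable]: "f \<in> borel_measurable borel" and f: "\<And>y. 0 \<le> f y"
    and M: "(\<integral>\<^sup>+y. ennreal (f y) \<partial>lborel) \<le> ennreal M" "M > 0" and s: "s > 0"
  shows "(\<integral>\<^sup>+y. ennreal (indicator {y. f y \<le> s} y * f y / norm (x - y)) \<partial>lborel)
           \<le> ennreal (coulomb_const * M powr (2/3) * s powr (1/3))"
proof -
  have [measurable]: "ball x r \<in> sets borel" for r by simp
  \<comment> \<open>The radius with \<open>s * R^3 = M\<close>. It balances the near part, of order
    \<open>s * R\<^sup>2\<close>, against the far part \<open>M / R\<close>; \<open>e1\<close> and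
    \<open>e2\<close> give their common value.\<close>
  define R where "R = (M / s) powr (1/3)"
  have R: "R > 0" using M s by (simp add: R_def)
  have e1: "s * R\<^sup>2 = M powr (2/3) * s powr (1/3)"
  proof -
    have "R\<^sup>2 = (M/s) powr (2/3)"
      by (simp add: R_def power2_eq_square powr_add[symmetric])
    also have "\<dots> = M powr (2/3) / s powr (2/3)" using M s by (simp add: powr_divide)
    finally have "s * R\<^sup>2 = M powr (2/3) * (s powr 1 / s powr (2/3))" using s by simp
    also have "s powr 1 / s powr (2/3) = s powr (1/3)" using s powr_diff[of s 1 "2/3"] by simp
    finally show ?thesis .
  qed
  have e2: "M / R = M powr (2/3) * s powr (1/3)"
  proof -
    have "M / R = (M powr 1 / M powr (1/3)) * s powr (1/3)"
      using M s by (simp add: R_def powr_divide)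
    also have "M powr 1 / M powr (1/3) = M powr (2/3)" using M powr_diff[of M 1 "1/3"] by simp
    finally show ?thesis .
  qed
  have "(\<integral>\<^sup>+y. ennreal (indicator {y. f y \<le> s} y * f y / norm (x - y)) \<partial>lborel)
     \<le> (\<integral>\<^sup>+y. ennreal s * ennreal (indicator (ball x R) y / norm (x - y))
            + ennreal (1/R) * ennreal (f y) \<partial>lborel)"
  proof (intro nn_integral_mono)
    fix y
    have "indicator {y. f y \<le> s} y * f y / norm (x - y)
            \<le> s * (indicator (ball x R) y / norm (x - y)) + 1/R * f y"
    proof (cases "y \<in> ball x R")
      case True
      have "indicator {y. f y \<le> s} y * f y \<le> s" using s by (auto simp: indicator_def)
      then have "indicator {y. f y \<le> s} y * f y / norm (x - y) \<le> s / norm (x - y)"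
        by (intro divide_right_mono) auto
      moreover have "1/R * f y \<ge> 0" using R f by simp
      ultimately show ?thesis using True by simp
    next
      case False
      then have "R \<le> norm (x - y)" by (simp add: dist_norm)
      then have "indicator {y. f y \<le> s} y * f y / norm (x - y) \<le> f y / R"
        using R f by (intro frac_le) (auto simp: indicator_def)
      then show ?thesis using False by simp
    qed
    then show "ennreal (indicator {y. f y \<le> s} y * f y / norm (x - y))
       \<le> ennreal s * ennreal (indicator (ball x R) y / norm (x - y)) + ennreal (1/R) * ennreal (f y)"
      using s R f
      by (subst (1 2) ennreal_mult[symmetric]) (auto simp: ennreal_plus[symmetric] simp del: ennreal_plus intro!: ennreal_leI)
  qed
  also have "\<dots> = ennreal s * (\<integral>\<^sup>+y. ennreal (indicator (ball x R) y / norm (x - y)) \<partial>lborel)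
                    + ennreal (1/R) * (\<integral>\<^sup>+y. ennreal (f y) \<partial>lborel)"
    by (simp add: nn_integral_add nn_integral_cmult)
  also have "\<dots> \<le> ennreal s * ennreal (8/3 * unit_ball_vol 3 * R\<^sup>2) + ennreal (1/R) * ennreal M"
    by (intro add_mono mult_left_mono nn_integral_inverse_norm_ball R M) auto
  also have "\<dots> = ennreal (s * (8/3 * unit_ball_vol 3 * R\<^sup>2) + 1/R * M)"
    using s R M by (simp add: ennreal_mult[symmetric] ennreal_plus[symmetric] del: ennreal_plus)
  also have "s * (8/3 * unit_ball_vol 3 * R\<^sup>2) + 1/R * M = 8/3 * unit_ball_vol 3 * (s * R\<^sup>2) + M / R"
    by simp
  also have "\<dots> = coulomb_const * M powr (2/3) * s powr (1/3)"
    unfolding e1 e2 by (simp add: coulomb_const_def algebra_simps)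
  finally show ?thesis .
qed

lemma coulomb_energy_bound:
  fixes f :: "real^3 \<Rightarrow> real" and M :: real
  assumes [measurable]: "f \<in> borel_measurable borel" and f: "\<And>y. 0 \<le> f y"
    and M: "(\<integral>\<^sup>+y. ennreal (f y) \<partial>lborel) \<le> ennreal M" "M > 0"
  shows "(\<integral>\<^sup>+x. \<integral>\<^sup>+y. ennreal (f x * f y / norm (x - y)) \<partial>lborel \<partial>lborel)
           \<le> ennreal (2 * coulomb_const * M powr (2/3)) * (\<integral>\<^sup>+x. ennreal (f x powr (4/3)) \<partial>lborel)"
proof -
  \<comment> \<open>Every pair lies in \<open>f y \<le> f x\<close> or in its mirror image, and in
    both on ties. Hence the full kernel is at most \<open>k x y + k y x\<close>, and Fubini gives
    both terms the same integral.\<close>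
  define k where "k x y = ennreal (indicator {y. f y \<le> f x} y * (f x * f y / norm (x - y)))" for x y
  have [measurable]: "(\<lambda>(x,y). k x y) \<in> borel_measurable (lborel \<Otimes>\<^sub>M lborel)"
    unfolding k_def indicator_def mem_Collect_eq by measurable
  then have [measurable]: "(\<lambda>y. k x y) \<in> borel_measurable lborel"
     "(\<lambda>y. k y x) \<in> borel_measurable lborel" for x
    by measurable
  let ?I = "\<integral>\<^sup>+x. \<integral>\<^sup>+y. k x y \<partial>lborel \<partial>lborel"
  have "(\<integral>\<^sup>+x. \<integral>\<^sup>+y. ennreal (f x * f y / norm (x - y)) \<partial>lborel \<partial>lborel)
      \<le> (\<integral>\<^sup>+x. \<integral>\<^sup>+y. k x y + k y x \<partial>lborel \<partial>lborel)"
    using f by (intro nn_integral_mono) (auto simp: k_def indicator_def norm_minus_commute mult.commute)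
  also have "\<dots> = ?I + (\<integral>\<^sup>+x. \<integral>\<^sup>+y. k y x \<partial>lborel \<partial>lborel)"
    by (simp add: nn_integral_add)
  also have "(\<integral>\<^sup>+x. \<integral>\<^sup>+y. k y x \<partial>lborel \<partial>lborel) = ?I"
    by (subst lborel_pair.Fubini') auto
  also have "?I + ?I = 2 * ?I" by (simp add: mult_2)
  also have "?I \<le> (\<integral>\<^sup>+x. ennreal (coulomb_const * M powr (2/3)) * ennreal (f x powr (4/3)) \<partial>lborel)"
  proof (intro nn_integral_mono)
    fix x
    show "(\<integral>\<^sup>+y. k x y \<partial>lborel) \<le> ennreal (coulomb_const * M powr (2/3)) * ennreal (f x powr (4/3))"
    \<comment> \<open>The bound for the bounded part requires a positive level
      \<open>s = f x\<close>.\<close>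
    proof (cases "f x = 0")
      case True
      then show ?thesis by (simp add: k_def)
    next
      case False
      then have fx: "f x > 0" using f[of x] by simp
      have "(\<integral>\<^sup>+y. k x y \<partial>lborel)
          = (\<integral>\<^sup>+y. ennreal (f x) * ennreal (indicator {y. f y \<le> f x} y * f y / norm (x - y)) \<partial>lborel)"
        using f fx unfolding k_def
        by (intro nn_integral_cong, subst ennreal_mult[symmetric]) (auto simp: mult_ac)
      also have "\<dots> = ennreal (f x) * (\<integral>\<^sup>+y. ennreal (indicator {y. f y \<le> f x} y * f y / norm (x - y)) \<partial>lborel)"
        by (intro nn_integral_cmult) measurable
      also have "\<dots> \<le> ennreal (f x) * ennreal (coulomb_const * M powr (2/3) * f x powr (1/3))"
        by (intro mult_left_mono potential_bound_of_bounded_part f M fx) auto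
      also have "\<dots> = ennreal (coulomb_const * M powr (2/3) * (f x powr 1 * f x powr (1/3)))"
        using fx coulomb_const_pos by (simp add: ennreal_mult[symmetric] mult_ac)
      also have "f x powr 1 * f x powr (1/3) = f x powr (4/3)"
        using fx powr_add[of "f x" 1 "1/3"] by simp
      finally show ?thesis using coulomb_const_pos by (simp add: ennreal_mult)
    qed
  qed
  also have "\<dots> = ennreal (coulomb_const * M powr (2/3)) * (\<integral>\<^sup>+x. ennreal (f x powr (4/3)) \<partial>lborel)"
    by (intro nn_integral_cmult) measurable
  finally show ?thesis
    using coulomb_const_pos by (simp add: ennreal_mult mult_left_mono mult.assoc)
qed


section \<open>Growth of the internal energy density\<close>

lemma C1_on_imp_continuous_on: "C1_on S f \<Longrightarrow> continuous_on S f"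
  unfolding C1_on_def by (meson has_field_derivative_imp_has_derivative has_derivative_continuous_on)

text \<open>Near 0 integrability is the hypothesis on \<open>p\<close>; from 1 on the integrand is
  continuous on a compact interval.\<close>

lemma set_integrable_pressure:
  fixes p :: "real \<Rightarrow> real"
  assumes "continuous_on {0..} p" "interval_lebesgue_integrable lborel 0 1 (\<lambda>s. p s / s\<^sup>2)"
  shows "set_integrable lborel {0<..<s} (\<lambda>t. p t / t\<^sup>2)"
proof -
  have 1: "set_integrable lborel {0<..<1} (\<lambda>t. p t / t\<^sup>2)"
    using assms(2) by (simp add: interval_lebesgue_integrable_def zero_ereal_def one_ereal_def)
  have 2: "set_integrable lborel {1..s} (\<lambda>t. p t / t\<^sup>2)"
    by (intro borel_integrable_atLeastAtMost' continuous_intros continuous_on_subset[OF assms(1)]) auto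
  show ?thesis
    by (rule set_integrable_subset[OF set_integrable_Un[OF 1 2]]) auto
qed

text \<open>The sign condition matters: for \<open>s < 0\<close> the interval integral is oriented
  and runs over negative arguments, while the set integral is 0.\<close>

lemma internal_energy_eq:
  assumes "0 \<le> s"
  shows "internal_energy p s = s * (LBINT t:{0<..<s}. p t / t\<^sup>2)"
  using assms by (simp add: internal_energy_def interval_lebesgue_integral_def zero_ereal_def)

lemma mono_pressure_integral:
  fixes p :: "real \<Rightarrow> real"
  assumes "continuous_on {0..} p" "interval_lebesgue_integrable lborel 0 1 (\<lambda>s. p s / s\<^sup>2)"
    and "\<And>s. 0 \<le> s \<Longrightarrow> 0 \<le> p s"
  shows "mono (\<lambda>s. LBINT t:{0<..<s}. p t / t\<^sup>2)"
proof (rule monoI)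
  fix r s :: real
  assume "r \<le> s"
  then show "(LBINT t:{0<..<r}. p t / t\<^sup>2) \<le> (LBINT t:{0<..<s}. p t / t\<^sup>2)"
    using set_integrable_pressure[OF assms(1,2), of r] set_integrable_pressure[OF assms(1,2), of s] assms(3)
    unfolding set_lebesgue_integral_def set_integrable_def
    by (intro integral_mono) (auto simp: indicator_def)
qed

lemma internal_energy_nonneg:
  assumes "\<And>s. 0 \<le> s \<Longrightarrow> 0 \<le> p s" "0 \<le> s"
  shows "0 \<le> internal_energy p s"
proof -
  have "0 \<le> (LBINT t:{0<..<s}. p t / t\<^sup>2)"
    unfolding set_lebesgue_integral_def using assms
    by (intro integral_nonneg_AE) (auto simp: indicator_def)
  then show ?thesis using assms(2) by (simp add: internal_energy_eq)
qed

text \<open>The half interval from \<open>s/2\<close> to \<open>s\<close> suffices: there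
  \<open>p t / t\<^sup>2\<close> is at least \<open>K/2 * (s/2) powr \<gamma> / s\<^sup>2\<close>.
  Multiplying by the length \<open>s/2\<close> and the prefactor \<open>s\<close> leaves a multiple
  of \<open>s powr \<gamma>\<close>.\<close>

lemma internal_energy_growth:
  fixes p :: "real \<Rightarrow> real" and K \<gamma> :: real
  assumes "continuous_on {0..} p" "interval_lebesgue_integrable lborel 0 1 (\<lambda>s. p s / s\<^sup>2)"
    and nonneg: "\<And>s. 0 \<le> s \<Longrightarrow> 0 \<le> p s"
    and lim: "((\<lambda>s. p s / s powr \<gamma>) \<longlongrightarrow> K) at_top" and K: "0 < K" and \<gamma>: "0 \<le> \<gamma>"
  shows "\<exists>k>0. \<exists>S>0. \<forall>s\<ge>S. k * s powr \<gamma> \<le> internal_energy p s"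
proof -
  have "eventually (\<lambda>s. K/2 < p s / s powr \<gamma>) at_top"
    using lim K by (intro order_tendstoD(1)) auto
  then obtain S0 where S0: "\<And>s. s \<ge> S0 \<Longrightarrow> K/2 < p s / s powr \<gamma>"
    by (auto simp: eventually_at_top_linorder)
  define S where "S = max S0 1"
  have S: "S > 0" by (simp add: S_def)
  have p: "K/2 * t powr \<gamma> \<le> p t" if "t \<ge> S" for t
    using S0[of t] that by (auto simp: S_def field_simps)
  define k where "k = K/4 * (1/2) powr \<gamma>"
  \<comment> \<open>With \<open>s \<ge> 2 * S\<close> the whole half interval lies where
    \<open>p t\<close> is at least \<open>K/2 * t powr \<gamma>\<close>.\<close>
  have "k * s powr \<gamma> \<le> internal_energy p s" if s: "s \<ge> 2 * S" for s
  proof -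
    have s0: "s > 0" using s S by simp
    define c where "c = K/2 * (s/2) powr \<gamma> / s\<^sup>2"
    have "c * (s/2) = (LBINT t:{s/2<..<s}. c)"
      using s0 by (simp add: set_lebesgue_integral_def)
    also have "\<dots> \<le> (LBINT t:{0<..<s}. p t / t\<^sup>2)"
    proof -
      have "indicator {s/2<..<s} t *\<^sub>R c \<le> indicator {0<..<s} t *\<^sub>R (p t / t\<^sup>2)" for t
      proof (cases "t \<in> {s/2<..<s}")
        case True
        have "K/2 * (s/2) powr \<gamma> \<le> K/2 * t powr \<gamma>"
          using True s0 K \<gamma> by (intro mult_left_mono powr_mono2) auto
        also have "\<dots> \<le> p t" using True s by (intro p) auto
        finally have "c \<le> p t / t\<^sup>2"
          unfolding c_def using True s0 nonneg[of t] by (intro frac_le power_mono) auto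
        then show ?thesis using True s0 by auto
      next
        case False
        then show ?thesis using nonneg[of t] by (auto simp: indicator_def)
      qed
      moreover have "integrable lborel (indicat_real {s/2<..<s})"
        using s0 by (intro integrable_real_indicator) auto
      ultimately show ?thesis
        using set_integrable_pressure[OF assms(1,2), of s]
        unfolding set_lebesgue_integral_def set_integrable_def
        by (intro integral_mono) auto
    qed
    finally have "s * (c * (s/2)) \<le> internal_energy p s"
      using s0 by (simp add: internal_energy_eq)
    moreover have "(s/2) powr \<gamma> = s powr \<gamma> * (1/2) powr \<gamma>"
      using powr_mult[of s "1/2" \<gamma>] s0 by simp
    then have "s * (c * (s/2)) = k * s powr \<gamma>"
      using s0 by (simp add: c_def k_def power2_eq_square)
    ultimately show ?thesis by simp
  qed
  moreover have "k > 0" using K by (simp add: k_def)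
  ultimately show ?thesis
    using S by (intro exI[of _ k] conjI exI[of _ "2 * S"]) auto
qed

text \<open>For large \<open>s\<close> the growth bound absorbs \<open>s powr (4/3)\<close>; for
  \<open>s\<close> below a threshold \<open>T\<close> it is at most \<open>T powr (1/3) * s\<close>.
  The linear term is harmless, since it integrates to \<open>b\<close> times the mass. The
  disjunction treats the critical exponent, with \<open>a\<close> at least \<open>a0 = 1/k\<close>,
  together with the supercritical one, where any \<open>a > 0\<close> is allowed.\<close>

lemma powr_le_internal_energy:
  fixes p :: "real \<Rightarrow> real" and K \<gamma> :: real
  assumes "continuous_on {0..} p" "interval_lebesgue_integrable lborel 0 1 (\<lambda>s. p s / s\<^sup>2)"
    and nonneg: "\<And>s. 0 \<le> s \<Longrightarrow> 0 \<le> p s"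
    and "((\<lambda>s. p s / s powr \<gamma>) \<longlongrightarrow> K) at_top" "0 < K" and \<gamma>: "4/3 \<le> \<gamma>"
  shows "\<exists>a0>0. \<forall>a>0. a0 \<le> a \<or> 4/3 < \<gamma> \<longrightarrow>
           (\<exists>b\<ge>0. \<forall>s\<ge>0. s powr (4/3) \<le> a * internal_energy p s + b * s)"
proof -
  obtain k S where k: "k > 0" and S: "S > 0"
    and kS: "\<And>s. s \<ge> S \<Longrightarrow> k * s powr \<gamma> \<le> internal_energy p s"
    using internal_energy_growth[OF assms(1-5)] \<gamma> by auto
  have "\<exists>b\<ge>0. \<forall>s\<ge>0. s powr (4/3) \<le> a * internal_energy p s + b * s"
    if a: "a > 0" "1/k \<le> a \<or> 4/3 < \<gamma>" for a
  proof -
    \<comment> \<open>A negative exponent makes the power tend to 0. For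
      \<open>\<gamma> = 4/3\<close> the power is 1, as \<open>s \<ge> S > 0\<close>, and
      \<open>a \<ge> 1/k\<close> is exactly what is required.\<close>
    have "\<exists>T\<ge>S. \<forall>s\<ge>T. s powr (4/3 - \<gamma>) \<le> a * k"
    proof (cases "4/3 < \<gamma>")
      case True
      have "((\<lambda>s. s powr (4/3 - \<gamma>)) \<longlongrightarrow> 0) at_top"
        using True by (intro tendsto_neg_powr filterlim_ident) auto
      then have "eventually (\<lambda>s. s powr (4/3 - \<gamma>) < a * k) at_top"
        using a k by (intro order_tendstoD(2)) auto
      then obtain T where "\<And>s. s \<ge> T \<Longrightarrow> s powr (4/3 - \<gamma>) < a * k"
        by (auto simp: eventually_at_top_linorder)
      then show ?thesis by (intro exI[of _ "max T S"]) (auto intro: less_imp_le)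
    next
      case False
      then have g: "\<gamma> = 4/3" and "1 \<le> a * k" using \<gamma> a k by (auto simp: field_simps)
      then show ?thesis unfolding g using S by (intro exI[of _ S]) auto
    qed
    then obtain T where T: "T \<ge> S" "\<And>s. s \<ge> T \<Longrightarrow> s powr (4/3 - \<gamma>) \<le> a * k" by auto
    have "s powr (4/3) \<le> a * internal_energy p s + T powr (1/3) * s" if s: "s \<ge> 0" for s
    proof (cases "s \<ge> T")
      case True
      have "s powr (4/3) = s powr (4/3 - \<gamma>) * s powr \<gamma>"
        by (simp add: powr_add[symmetric])
      also have "\<dots> \<le> a * k * s powr \<gamma>" using T(2)[OF True] by (intro mult_right_mono) auto
      also have "\<dots> \<le> a * internal_energy p s"
        using kS[of s] True T a by (simp add: mult.assoc)
      finally show ?thesis using s by (simp add: add_increasing2)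
    next
      case False
      have "s powr (4/3) = s powr (1/3) * s"
        using powr_add[of s "1/3" 1] s by simp
      also have "\<dots> \<le> T powr (1/3) * s"
        using False s by (intro mult_right_mono powr_mono2) auto
      finally show ?thesis
        using a internal_energy_nonneg[of p s] nonneg s by (simp add: add_increasing)
    qed
    then show ?thesis by (intro exI[of _ "T powr (1/3)"]) auto
  qed
  then show ?thesis using k by (intro exI[of _ "1/k"]) auto
qed

section \<open>Measurability of the internal energy and the rotation term\<close>

lemma borel_measurable_internal_energy:
  fixes \<rho> :: "'a::euclidean_space \<Rightarrow> real"
  assumes "continuous_on {0..} p" "interval_lebesgue_integrable lborel 0 1 (\<lambda>s. p s / s\<^sup>2)"
    and "\<And>s. 0 \<le> s \<Longrightarrow> 0 \<le> p s"
    and [measurable]: "\<rho> \<in> borel_measurable lebesgue" and nonneg: "AE x in lebesgue. 0 \<le> \<rho> x"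
  shows "(\<lambda>x. internal_energy p (\<rho> x)) \<in> borel_measurable lebesgue"
proof (rule borel_measurable_AE)
  \<comment> \<open>The set integral is monotone in its upper limit, hence Borel. It agrees with
    \<open>internal_energy\<close> only where \<open>\<rho>\<close> is nonnegative, so the result is
    transferred almost everywhere.\<close>
  have [measurable]: "(\<lambda>s. LBINT t:{0<..<s}. p t / t\<^sup>2) \<in> borel_measurable borel"
    by (intro borel_measurable_mono mono_pressure_integral assms(1-3))
  show "(\<lambda>x. \<rho> x * (LBINT t:{0<..<\<rho> x}. p t / t\<^sup>2)) \<in> borel_measurable lebesgue"
    by measurable
  show "AE x in lebesgue. \<rho> x * (LBINT t:{0<..<\<rho> x}. p t / t\<^sup>2) = internal_energy p (\<rho> x)"
    using nonneg by eventually_elim (simp add: internal_energy_eq)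
qed

lemma borel_measurable_axis_dist [measurable]: "axis_dist \<in> borel_measurable borel"
  unfolding axis_dist_def
  by (intro borel_measurable_continuous_onI continuous_intros)

lemma axis_dist_less_in_sets_lebesgue: "{x. axis_dist x < r} \<in> sets lebesgue"
proof -
  have "{x \<in> space borel. axis_dist x < r} \<in> sets borel" by measurable
  then show ?thesis by (simp add: sets_completionI_sets)
qed

lemma cyl_mass_mono:
  assumes "integrable lebesgue \<rho>" "AE x in lebesgue. 0 \<le> \<rho> x" "r \<le> s"
  shows "cyl_mass \<rho> r \<le> cyl_mass \<rho> s"
  unfolding cyl_mass_def set_lebesgue_integral_def
proof (rule integral_mono_AE)
  show "AE x in lebesgue. indicat_real {x. axis_dist x < r} x *\<^sub>R \<rho> x
          \<le> indicat_real {x. axis_dist x < s} x *\<^sub>R \<rho> x"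
    using assms(2) by eventually_elim (use assms(3) in \<open>auto simp: indicator_def\<close>)
qed (intro integrable_mult_indicator axis_dist_less_in_sets_lebesgue assms)+

lemma cyl_mass_bounds:
  assumes "integrable lebesgue \<rho>" "AE x in lebesgue. 0 \<le> \<rho> x"
  shows "cyl_mass \<rho> r \<in> {0..(LINT x|lebesgue. \<rho> x)}"
proof -
  have "0 \<le> cyl_mass \<rho> r"
    unfolding cyl_mass_def set_lebesgue_integral_def using assms(2)
    by (intro integral_nonneg_AE) (auto simp: indicator_def)
  moreover have "cyl_mass \<rho> r \<le> (LINT x|lebesgue. \<rho> x)"
    unfolding cyl_mass_def set_lebesgue_integral_def
  proof (rule integral_mono_AE)
    show "AE x in lebesgue. indicat_real {x. axis_dist x < r} x *\<^sub>R \<rho> x \<le> \<rho> x"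
      using assms(2) by eventually_elim (auto simp: indicator_def)
  qed (intro integrable_mult_indicator axis_dist_less_in_sets_lebesgue assms)+
  ultimately show ?thesis by simp
qed

text \<open>\<open>cyl_mass \<rho>\<close> is monotone, hence Borel, and takes values in
  \<open>{0..M}\<close>. Since \<open>L\<close> is controlled only there, it is replaced by its
  extension by 0, which is Borel.\<close>

lemma borel_measurable_rotation_term:
  assumes "integrable lebesgue \<rho>" "AE x in lebesgue. 0 \<le> \<rho> x" "(LINT x|lebesgue. \<rho> x) = M"
    and L: "continuous_on {0..M} L"
  shows "rotation_term L \<rho> \<in> borel_measurable lebesgue"
proof -
  have [measurable]: "\<rho> \<in> borel_measurable lebesgue" using assms(1) by simp
  have "mono (cyl_mass \<rho>)" by (intro monoI cyl_mass_mono assms)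
  then have [measurable]: "cyl_mass \<rho> \<in> borel_measurable borel" by (rule borel_measurable_mono)
  have "(\<lambda>m. indicator {0..M} m *\<^sub>R L m) \<in> borel_measurable borel"
    by (intro borel_measurable_continuous_on_indicator L) simp
  then have [measurable]: "(\<lambda>m. indicat_real {0..M} m * L m) \<in> borel_measurable borel" by simp
  have [measurable]: "axis_dist \<in> borel_measurable lebesgue"
    using borel_measurable_axis_dist by (simp add: measurable_completion)
  have "L (cyl_mass \<rho> r) = indicat_real {0..M} (cyl_mass \<rho> r) * L (cyl_mass \<rho> r)" for r
    using cyl_mass_bounds[OF assms(1,2), of r] assms(3) by simp
  then have "rotation_term L \<rho> = (\<lambda>x. \<rho> x * (indicat_real {0..M} (cyl_mass \<rho> (axis_dist x))
       * L (cyl_mass \<rho> (axis_dist x))) / (axis_dist x)\<^sup>2)"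
    by (auto simp: rotation_term_def fun_eq_iff)
  also have "\<dots> \<in> borel_measurable lebesgue" by measurable
  finally show ?thesis .
qed

section \<open>The gravitational energy of Lebesgue measurable densities\<close>

lemma potential_nonneg:
  assumes "AE x in lebesgue. 0 \<le> \<rho> x"
  shows "0 \<le> potential \<rho> x"
  unfolding potential_def
  by (intro integral_nonneg_AE) (use assms in \<open>eventually_elim, simp\<close>)

text \<open>Transfers \<open>coulomb_energy_bound\<close> to Bochner integrals by passing to a Borel
  representative of the density.\<close>

lemma integral_potential_le:
  fixes \<rho> :: "real^3 \<Rightarrow> real" and M :: real
  assumes \<rho>: "integrable lebesgue \<rho>" "AE x in lebesgue. 0 \<le> \<rho> x" "(LINT x|lebesgue. \<rho> x) = M"
    and M: "M > 0"
    and pot: "integrable lebesgue (\<lambda>x. \<rho> x * potential \<rho> x)"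
    and powr: "integrable lebesgue (\<lambda>x. \<rho> x powr (4/3))"
  shows "(LINT x|lebesgue. \<rho> x * potential \<rho> x)
           \<le> 2 * coulomb_const * M powr (2/3) * (LINT x|lebesgue. \<rho> x powr (4/3))"
proof -
  have [measurable]: "\<rho> \<in> borel_measurable lebesgue" using \<rho>(1) by simp
  obtain f0 where [measurable]: "f0 \<in> borel_measurable lborel"
    and f0: "AE x in lborel. \<rho> x = f0 x"
    using completion_ex_borel_measurable_real[of \<rho> lborel] by auto
  \<comment> \<open>The truncation makes the representative nonnegative everywhere, not just almost
    everywhere.\<close>
  define f where "f x = max 0 (f0 x)" for x
  have [measurable]: "f \<in> borel_measurable borel" unfolding f_def by measurable
  have f: "0 \<le> f x" for x by (simp add: f_def)
  have eq: "AE x in lebesgue. \<rho> x = f x"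
    using AE_completion[OF f0] \<rho>(2) by eventually_elim (simp add: f_def)
  have [measurable]: "(\<lambda>x::real^3. x) \<in> borel_measurable lebesgue"
    by (simp add: measurable_completion)
  \<comment> \<open>Only an inequality holds: where the integral diverges, \<open>potential\<close>
    is 0 by convention. This is the direction required for an upper bound.\<close>
  have le: "ennreal (potential \<rho> x) \<le> (\<integral>\<^sup>+y. ennreal (f y / norm (x - y)) \<partial>lborel)" for x
  proof -
    have "potential \<rho> x = enn2real (\<integral>\<^sup>+y. ennreal (\<rho> y / norm (x - y)) \<partial>lebesgue)"
      unfolding potential_def
      by (intro integral_eq_nn_integral) (measurable, use \<rho>(2) in \<open>eventually_elim, simp\<close>)
    also have "(\<integral>\<^sup>+y. ennreal (\<rho> y / norm (x - y)) \<partial>lebesgue)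
             = (\<integral>\<^sup>+y. ennreal (f y / norm (x - y)) \<partial>lebesgue)"
      by (intro nn_integral_cong_AE) (use eq in \<open>eventually_elim, simp\<close>)
    also have "\<dots> = (\<integral>\<^sup>+y. ennreal (f y / norm (x - y)) \<partial>lborel)"
      by (rule nn_integral_completion)
    finally show ?thesis by (simp add: ennreal_enn2real_if)
  qed
  have mass: "(\<integral>\<^sup>+y. ennreal (f y) \<partial>lborel) \<le> ennreal M"
  proof -
    have "(\<integral>\<^sup>+y. ennreal (f y) \<partial>lborel) = (\<integral>\<^sup>+y. ennreal (f y) \<partial>lebesgue)"
      by (simp add: nn_integral_completion)
    also have "\<dots> = (\<integral>\<^sup>+y. ennreal (\<rho> y) \<partial>lebesgue)"
      by (intro nn_integral_cong_AE) (use eq in \<open>eventually_elim, simp\<close>)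
    also have "\<dots> = ennreal M" using \<rho> by (simp add: nn_integral_eq_integral)
    finally show ?thesis by simp
  qed
  have "ennreal (LINT x|lebesgue. \<rho> x * potential \<rho> x)
          = (\<integral>\<^sup>+x. ennreal (\<rho> x * potential \<rho> x) \<partial>lebesgue)"
    using pot \<rho>(2) by (intro nn_integral_eq_integral[symmetric])
      (auto simp: potential_nonneg[OF \<rho>(2)] elim!: eventually_mono)
  also have "\<dots> \<le> (\<integral>\<^sup>+x. ennreal (f x) * (\<integral>\<^sup>+y. ennreal (f y / norm (x - y)) \<partial>lborel) \<partial>lebesgue)"
  proof (intro nn_integral_mono_AE)
    show "AE x in lebesgue. ennreal (\<rho> x * potential \<rho> x)
        \<le> ennreal (f x) * (\<integral>\<^sup>+y. ennreal (f y / norm (x - y)) \<partial>lborel)"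
      using eq
      by eventually_elim (simp add: ennreal_mult f potential_nonneg[OF \<rho>(2)] mult_left_mono le)
  qed
  also have "\<dots> = (\<integral>\<^sup>+x. \<integral>\<^sup>+y. ennreal (f x * f y / norm (x - y)) \<partial>lborel \<partial>lborel)"
    unfolding nn_integral_completion
    by (intro nn_integral_cong, subst nn_integral_cmult[symmetric])
      (auto simp: f ennreal_mult[symmetric])
  also have "\<dots> \<le> ennreal (2 * coulomb_const * M powr (2/3)) * (\<integral>\<^sup>+x. ennreal (f x powr (4/3)) \<partial>lborel)"
    by (intro coulomb_energy_bound f mass M) auto
  also have "(\<integral>\<^sup>+x. ennreal (f x powr (4/3)) \<partial>lborel) = (\<integral>\<^sup>+x. ennreal (f x powr (4/3)) \<partial>lebesgue)"
    by (simp add: nn_integral_completion)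
  also have "\<dots> = (\<integral>\<^sup>+x. ennreal (\<rho> x powr (4/3)) \<partial>lebesgue)"
    by (intro nn_integral_cong_AE) (use eq in \<open>eventually_elim, simp\<close>)
  also have "\<dots> = ennreal (LINT x|lebesgue. \<rho> x powr (4/3))"
    using powr by (intro nn_integral_eq_integral) auto
  finally show ?thesis
    using coulomb_const_pos by (simp add: ennreal_mult[symmetric] ennreal_le_iff)
qed

section \<open>Integrability of the separate energy terms and coercivity\<close>

lemma admissible_integrable:
  fixes p L :: "real \<Rightarrow> real"
  assumes p: "continuous_on {0..} p" "interval_lebesgue_integrable lborel 0 1 (\<lambda>s. p s / s\<^sup>2)"
      "\<And>s. 0 \<le> s \<Longrightarrow> 0 \<le> p s"
    and L: "continuous_on {0..M} L" "\<And>m. m \<in> {0..M} \<Longrightarrow> 0 \<le> L m"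
    and \<rho>: "\<rho> \<in> admissible p L M"
  shows "AE x in lebesgue. 0 \<le> internal_energy p (\<rho> x)"
    and "AE x in lebesgue. 0 \<le> rotation_term L \<rho> x"
    and "integrable lebesgue (\<lambda>x. internal_energy p (\<rho> x))"
    and "integrable lebesgue (rotation_term L \<rho>)"
    and "integrable lebesgue (\<lambda>x. \<rho> x * potential \<rho> x)"
proof -
  let ?T = "\<lambda>x. internal_energy p (\<rho> x) + rotation_term L \<rho> x + \<rho> x * potential \<rho> x"
  from \<rho> have nonneg: "AE x in lebesgue. 0 \<le> \<rho> x" and int: "integrable lebesgue \<rho>"
    and mass: "(LINT x|lebesgue. \<rho> x) = M" and T: "integrable lebesgue ?T"
    by (auto simp: admissible_def)
  have mA [measurable]: "(\<lambda>x. internal_energy p (\<rho> x)) \<in> borel_measurable lebesgue"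
    using int by (intro borel_measurable_internal_energy p nonneg) auto
  have mR [measurable]: "rotation_term L \<rho> \<in> borel_measurable lebesgue"
    by (intro borel_measurable_rotation_term[OF int nonneg mass] L)
  have [measurable]: "?T \<in> borel_measurable lebesgue" using T by simp
  \<comment> \<open>The potential term gets its measurability as the difference between the
    integrable total and the other two terms.\<close>
  have "(\<lambda>x. ?T x - internal_energy p (\<rho> x) - rotation_term L \<rho> x) \<in> borel_measurable lebesgue"
    by measurable
  then have mP: "(\<lambda>x. \<rho> x * potential \<rho> x) \<in> borel_measurable lebesgue" by simp
  show A: "AE x in lebesgue. 0 \<le> internal_energy p (\<rho> x)"
    using nonneg by eventually_elim (intro internal_energy_nonneg p)
  have "0 \<le> L (cyl_mass \<rho> r)" for r
    using cyl_mass_bounds[OF int nonneg] mass L(2) by auto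
  then show R: "AE x in lebesgue. 0 \<le> rotation_term L \<rho> x"
    using nonneg by (auto simp: rotation_term_def elim!: eventually_mono)
  have P: "AE x in lebesgue. 0 \<le> \<rho> x * potential \<rho> x"
    using nonneg by eventually_elim (simp add: potential_nonneg[OF nonneg])
  \<comment> \<open>All three terms are nonnegative almost everywhere, so each is dominated by their
    sum \<open>?T\<close>.\<close>
  show "integrable lebesgue (\<lambda>x. internal_energy p (\<rho> x))"
    by (rule Bochner_Integration.integrable_bound[OF T mA]) (use A R P in \<open>eventually_elim, simp\<close>)
  show "integrable lebesgue (rotation_term L \<rho>)"
    by (rule Bochner_Integration.integrable_bound[OF T mR]) (use A R P in \<open>eventually_elim, simp\<close>)
  show "integrable lebesgue (\<lambda>x. \<rho> x * potential \<rho> x)"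
    by (rule Bochner_Integration.integrable_bound[OF T mP]) (use A R P in \<open>eventually_elim, simp\<close>)
qed

text \<open>Integrating \<open>ab\<close> bounds the gravitational term \<open>P\<close> by
  \<open>c * a * A + c * b * M\<close>, and \<open>small\<close> says \<open>c * a \<le> 1\<close>.
  So \<open>2 * energy p L \<rho> = 2 * A + R - P\<close> is at least
  \<open>A + R - c * b * M\<close>.\<close>

lemma energy_coercive:
  fixes p L :: "real \<Rightarrow> real"
  assumes p: "continuous_on {0..} p" "interval_lebesgue_integrable lborel 0 1 (\<lambda>s. p s / s\<^sup>2)"
      "\<And>s. 0 \<le> s \<Longrightarrow> 0 \<le> p s"
    and L: "continuous_on {0..M} L" "\<And>m. m \<in> {0..M} \<Longrightarrow> 0 \<le> L m"
    and M: "M > 0"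
    and ab: "\<And>s. 0 \<le> s \<Longrightarrow> s powr (4/3) \<le> a * internal_energy p s + b * s"
    and small: "2 * coulomb_const * M powr (2/3) * a \<le> 1"
    and \<rho>: "\<rho> \<in> admissible p L M"
  shows "(LINT x|lebesgue. internal_energy p (\<rho> x) + 1/2 * rotation_term L \<rho> x)
           \<le> 2 * energy p L \<rho> + 2 * coulomb_const * M powr (2/3) * b * M"
proof -
  from \<rho> have nonneg: "AE x in lebesgue. 0 \<le> \<rho> x" and int: "integrable lebesgue \<rho>"
    and mass: "(LINT x|lebesgue. \<rho> x) = M"
    by (auto simp: admissible_def)
  have [measurable]: "\<rho> \<in> borel_measurable lebesgue" using int by simp
  note I = admissible_integrable[OF p L \<rho>]
  define A where "A = (LINT x|lebesgue. internal_energy p (\<rho> x))"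
  define R where "R = (LINT x|lebesgue. rotation_term L \<rho> x)"
  define P where "P = (LINT x|lebesgue. \<rho> x * potential \<rho> x)"
  define c where "c = 2 * coulomb_const * M powr (2/3)"
  have c: "c \<ge> 0" using coulomb_const_pos by (simp add: c_def)
  have A0: "A \<ge> 0" and R0: "R \<ge> 0"
    unfolding A_def R_def using I(1,2) by (auto intro: integral_nonneg_AE)
  have bnd: "integrable lebesgue (\<lambda>x. a * internal_energy p (\<rho> x) + b * \<rho> x)"
    by (intro Bochner_Integration.integrable_add integrable_mult_right I int)
  have ae: "AE x in lebesgue. \<rho> x powr (4/3) \<le> a * internal_energy p (\<rho> x) + b * \<rho> x"
    using nonneg by eventually_elim (rule ab)
  \<comment> \<open>Membership in \<open>admissible\<close> does not state this; it follows by
    domination from \<open>ab\<close>.\<close>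
  have powr: "integrable lebesgue (\<lambda>x. \<rho> x powr (4/3))"
    by (rule Bochner_Integration.integrable_bound[OF bnd])
      (measurable, use ae in \<open>eventually_elim, simp\<close>)
  have "P \<le> c * (LINT x|lebesgue. \<rho> x powr (4/3))"
    unfolding P_def c_def by (intro integral_potential_le int nonneg mass M I powr)
  also have "c * (LINT x|lebesgue. \<rho> x powr (4/3))
      \<le> c * (LINT x|lebesgue. a * internal_energy p (\<rho> x) + b * \<rho> x)"
    by (intro mult_left_mono integral_mono_AE powr bnd ae c)
  also have "\<dots> = c * a * A + c * b * M"
    using I(3) int mass by (simp add: A_def algebra_simps)
  finally have "P \<le> (c * a) * A + c * b * M" .
  also have "(c * a) * A \<le> 1 * A"
    using small A0 by (intro mult_right_mono) (auto simp: c_def)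
  finally have "P \<le> A + c * b * M" by simp
  moreover have "(LINT x|lebesgue. internal_energy p (\<rho> x) + 1/2 * rotation_term L \<rho> x) = A + 1/2 * R"
    using I by (simp add: A_def R_def)
  moreover have "energy p L \<rho> = A + 1/2 * R - 1/2 * P"
    using I by (simp add: energy_def A_def R_def P_def)
  ultimately show ?thesis using R0 by (simp add: c_def)
qed

section \<open>The critical mass and the choice of constants\<close>

theorem theorem4p1:
  fixes p :: "real \<Rightarrow> real" and K \<gamma> :: real
  assumes "C1_on {0..} p"
    and "interval_lebesgue_integrable lborel 0 1 (\<lambda>s. p s / s\<^sup>2)"
    and "((\<lambda>s. p s / s powr \<gamma>) \<longlongrightarrow> K) at_top"
    and "\<And>s. 0 \<le> s \<Longrightarrow> 0 \<le> p s"
    and "\<And>s. 0 < s \<Longrightarrow> 0 < deriv p s"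
    and "0 < K" and "4/3 \<le> \<gamma>"
  shows "\<exists>Mc :: ereal.
    (\<gamma> = 4/3 \<longrightarrow> 0 < Mc \<and> Mc < \<infinity>) \<and> (\<gamma> > 4/3 \<longrightarrow> Mc = \<infinity>) \<and>
    (\<forall>M L. 0 < M \<and> ereal M < Mc \<and>
        C1_on {0..M} L \<and> L 0 = 0 \<and> (\<forall>m\<in>{0..M}. 0 \<le> L m) \<longrightarrow>
      (\<exists>C1 C2 :: real. 0 < C1 \<and> 0 < C2 \<and>
        (\<forall>\<rho>\<in>admissible p L M.
          (LINT x|lebesgue. internal_energy p (\<rho> x) + 1/2 * rotation_term L \<rho> x)
            \<le> C1 * energy p L \<rho> + C2)))"
proof -
  have p: "continuous_on {0..} p" by (rule C1_on_imp_continuous_on) fact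
  obtain a0 where a0: "a0 > 0"
    and interp: "\<And>a. a > 0 \<Longrightarrow> a0 \<le> a \<or> 4/3 < \<gamma> \<Longrightarrow>
        \<exists>b\<ge>0. \<forall>s\<ge>0. s powr (4/3) \<le> a * internal_energy p s + b * s"
    using powr_le_internal_energy[OF p assms(2,4,3,6,7)] by blast
  \<comment> \<open>The mass at which \<open>1 / (2 * coulomb_const * M powr (2/3))\<close> equals
    \<open>a0\<close>. It is fixed before \<open>M\<close> and \<open>L\<close>.\<close>
  define M0 where "M0 = (1 / (2 * coulomb_const * a0)) powr (3/2)"
  define Mc where "Mc = (if 4/3 < \<gamma> then \<infinity> else ereal M0)"
  have M0: "M0 > 0" using a0 coulomb_const_pos by (simp add: M0_def)
  have "\<exists>C1 C2 :: real. 0 < C1 \<and> 0 < C2 \<and>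
        (\<forall>\<rho>\<in>admissible p L M.
          (LINT x|lebesgue. internal_energy p (\<rho> x) + 1/2 * rotation_term L \<rho> x)
            \<le> C1 * energy p L \<rho> + C2)"
    if M: "0 < M" "ereal M < Mc" and L: "C1_on {0..M} L" "\<forall>m\<in>{0..M}. 0 \<le> L m" for M L
  proof -
    \<comment> \<open>The largest coefficient that the smallness condition of
      \<open>energy_coercive\<close> permits; the condition becomes an equality.\<close>
    define a where "a = 1 / (2 * coulomb_const * M powr (2/3))"
    have a: "a > 0" using M coulomb_const_pos by (simp add: a_def)
    have "a0 \<le> a \<or> 4/3 < \<gamma>"
    proof (cases "4/3 < \<gamma>")
      case False
      then have "M powr (2/3) \<le> M0 powr (2/3)"
        using M by (intro powr_mono2) (auto simp: Mc_def)
      also have "M0 powr (2/3) = 1 / (2 * coulomb_const * a0)"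
        using a0 coulomb_const_pos by (simp add: M0_def powr_powr)
      finally show ?thesis
        using M a0 coulomb_const_pos by (simp add: a_def field_simps)
    qed simp
    then obtain b where b: "b \<ge> 0"
      and ab: "\<And>s. s \<ge> 0 \<Longrightarrow> s powr (4/3) \<le> a * internal_energy p s + b * s"
      using interp[OF a] by blast
    define C where "C = 2 * coulomb_const * M powr (2/3) * b * M"
    have "C \<ge> 0" using b M coulomb_const_pos by (simp add: C_def)
    \<comment> \<open>\<open>C\<close> may vanish, as \<open>b = 0\<close> is possible; adding 1
      makes the second constant positive.\<close>
    have "(LINT x|lebesgue. internal_energy p (\<rho> x) + 1/2 * rotation_term L \<rho> x)
            \<le> 2 * energy p L \<rho> + (C + 1)" if "\<rho> \<in> admissible p L M" for \<rho>
    proof -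
      have "(LINT x|lebesgue. internal_energy p (\<rho> x) + 1/2 * rotation_term L \<rho> x)
            \<le> 2 * energy p L \<rho> + C"
        unfolding C_def
        using L M ab that coulomb_const_pos
        by (intro energy_coercive[where a = a] p assms(2,4) C1_on_imp_continuous_on[OF L(1)])
          (auto simp: a_def)
      then show ?thesis by simp
    qed
    then show ?thesis using \<open>C \<ge> 0\<close> by (intro exI[of _ 2] exI[of _ "C + 1"]) auto
  qed
  then show ?thesis
    using M0 by (intro exI[of _ Mc]) (auto simp: Mc_def)
qed

end
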